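(* Let $\mathcal{H}$ be an infinite-dimensional separable complex Hilbert space and let $U(\mathcal{H})$ be its group of unitary operators. For $? \in \{co^*, s^*, w^*, co, s, w\}$ let $U(\mathcal{H})_?$ denote $U(\mathcal{H})$ endowed with the subspace topology from $B(\mathcal{H})_?$, where $co$, $s$, $w$ stand for the compact open, strong operator and weak operator topologies and $co^*$, $s^*$, $w^*$ for their $*$-counterparts. Then all these topologies agree on $U(\mathcal{H})$, i.e. $$U(\mathcal{H})_{co^*} = U(\mathcal{H})_{s^*} = U(\mathcal{H})_{w^*} = U(\mathcal{H})_{co} = U(\mathcal{H})_{s} = U(\mathcal{H})_{w}.$$ Moreover, the group $U(\mathcal{H})$ (under composition of operators) endowed with any of these topologies is a Polish group, i.e. a completely metrizable topological group.
   Context: $B(\mathcal{H})$ denotes the space of bounded linear operators $\mathcal{H}\to\mathcal{H}$, $T^*$ the adjoint of $T$, and $U(\mathcal{H})=\{U\in B(\mathcal{H}) : UU^*=U^*U=\mathrm{Id}_{\mathcal{H}}\}$. $B(\mathcal{H})_?$ denotes $B(\mathcal{H})$ endowed with the topology $?$. The topologies are described by their convergence: - Strong operator topology ($s$), pointwise convergence: $T_k\to_s T$ iff $T_kx\to Tx$ in norm for all $x\in\mathcal{H}$. - Weak operator topology ($w$): $T_k\to_w T$ iff $\langle T_kx,y\rangle\to\langle Tx,y\rangle$ for all $x,y\in\mathcal{H}$. - Compact open topology ($co$), uniform convergence on compact sets: $T_k\to_{co}T$ iff for every (norm-)compact $C\subset\mathcal{H}$, $T_k|_C\to T|_C$ uniformly.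 - For $?\in\{s,w,co\}$, the topology $?^*$: $T_k\to_{?^*}T$ iff both $T_k\to_? T$ and $T_k^*\to_? T^*$. Here $(T_k)$ ranges over nets in $B(\mathcal{H})$. Equivalently, $s$, $w$, $co$ are the locally convex topologies generated by the seminorms $T\mapsto|Tx|$ ($x \in \mathcal{H}$), $T\mapsto|\langle Tx,y\rangle|$ ($x,y\in\mathcal{H}$), and $T\mapsto\sup_{x\in C}|Tx|$ ($C\subset\mathcal{H}$ compact), respectively, and $?^*$ is the coarsest topology making both $T\mapsto T$ and $T\mapsto T^*$ continuous into $B(\mathcal{H})_?$. "Polish group" is used here to mean a completely metrizable topological group: a topological group whose topology is induced by some complete metric. *)

theory Defs
  imports "HOL-Analysis.Analysis" "HOL-Algebra.Group"
begin

class complex_hilbert_space = banach +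
  fixes scaleC :: "complex \<Rightarrow> 'a \<Rightarrow> 'a"
    and cinner :: "'a \<Rightarrow> 'a \<Rightarrow> complex"
  assumes scaleC_add_right: "scaleC a (x + y) = scaleC a x + scaleC a y"
    and scaleC_add_left: "scaleC (a + b) x = scaleC a x + scaleC b x"
    and scaleC_scaleC: "scaleC a (scaleC b x) = scaleC (a * b) x"
    and scaleC_one: "scaleC 1 x = x"
    and scaleR_scaleC: "scaleR r x = scaleC (complex_of_real r) x"
    and cinner_commute: "cinner x y = cnj (cinner y x)"
    and cinner_add_left: "cinner (x + y) z = cinner x z + cinner y z"
    and cinner_scaleC_left: "cinner (scaleC a x) y = a * cinner x y"
    and cinner_ge_zero: "0 \<le> Re (cinner x x)"
    and cinner_eq_zero_iff: "cinner x x = 0 \<longleftrightarrow> x = 0"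
    and norm_eq_sqrt_cinner: "norm x = sqrt (Re (cinner x x))"

global_interpretation complex_vector:
  vector_space "scaleC :: complex \<Rightarrow> 'a \<Rightarrow> 'a::complex_hilbert_space"
  by unfold_locales
    (simp_all add: scaleC_add_right scaleC_add_left scaleC_scaleC scaleC_one)

definition bounded_ops :: "('a::complex_hilbert_space \<Rightarrow> 'a) set" where
  "bounded_ops = {T. bounded_linear T \<and> (\<forall>c x. T (scaleC c x) = scaleC c (T x))}"

(* The adjoint exists, uniquely, for every member of bounded_ops (Riesz);
   elsewhere the value is irrelevant. *)
definition cadjoint :: "('a::complex_hilbert_space \<Rightarrow> 'a) \<Rightarrow> 'a \<Rightarrow> 'a" where
  "cadjoint T = (THE S. \<forall>x y. cinner (T x) y = cinner x (S y))"

definition unitary_ops :: "('a::complex_hilbert_space \<Rightarrow> 'a) set" where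
  "unitary_ops = {U \<in> bounded_ops. U \<circ> cadjoint U = id \<and> cadjoint U \<circ> U = id}"

definition unitary_group :: "('a::complex_hilbert_space \<Rightarrow> 'a) monoid" where
  "unitary_group = \<lparr>carrier = unitary_ops, mult = (\<circ>), one = id\<rparr>"

(* The locally convex topology on the function space V generated by the family P of
   seminorms on V, given by the subbase of all open seminorm balls. *)
definition seminorm_topology ::
    "('a \<Rightarrow> 'b::ab_group_add) set \<Rightarrow> (('a \<Rightarrow> 'b) \<Rightarrow> real) set \<Rightarrow> ('a \<Rightarrow> 'b) topology" where
  "seminorm_topology V P = topology_generated_by
     {{S \<in> V. p (\<lambda>x. S x - T x) < e} | T p e. T \<in> V \<and> p \<in> P \<and> 0 < e}"

definition strong_topology :: "('a::complex_hilbert_space \<Rightarrow> 'a) topology" where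
  "strong_topology = seminorm_topology bounded_ops {\<lambda>T. norm (T x) | x. True}"

definition weak_topology :: "('a::complex_hilbert_space \<Rightarrow> 'a) topology" where
  "weak_topology = seminorm_topology bounded_ops {\<lambda>T. cmod (cinner (T x) y) | x y. True}"

(* The empty compact set is left out: it would only contribute the zero seminorm,
   whereas the supremum of the empty set of reals is unspecified. *)
definition compact_open_topology :: "('a::complex_hilbert_space \<Rightarrow> 'a) topology" where
  "compact_open_topology = seminorm_topology bounded_ops
     {\<lambda>T. SUP x\<in>C. norm (T x) | C. compact C \<and> C \<noteq> {}}"

(* The coarsest topology on the space of X for which both the identity and the adjoint
   are continuous into X. *)
definition star_topology ::
    "('a::complex_hilbert_space \<Rightarrow> 'a) topology \<Rightarrow> ('a \<Rightarrow> 'a) topology" where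
  "star_topology X = topology_generated_by
     ({W. openin X W} \<union> {{T \<in> topspace X. cadjoint T \<in> W} | W. openin X W})"

definition topological_group :: "('a, 'b) monoid_scheme \<Rightarrow> 'a topology \<Rightarrow> bool" where
  "topological_group G X \<longleftrightarrow>
     group G \<and> topspace X = carrier G \<and>
     continuous_map (prod_topology X X) X (\<lambda>(x, y). x \<otimes>\<^bsub>G\<^esub> y) \<and>
     continuous_map X X (\<lambda>x. inv\<^bsub>G\<^esub> x)"

(* No separability is required here: "Polish" means completely metrizable. *)
definition polish_group :: "('a, 'b) monoid_scheme \<Rightarrow> 'a topology \<Rightarrow> bool" where
  "polish_group G X \<longleftrightarrow> topological_group G X \<and> completely_metrizable_space X"

end

theory Submission
  imports Defs
begin

text \<open>On unitaries \<open>\<parallel>S x - T x\<parallel>\<^sup>2 = 2 \<parallel>x\<parallel>\<^sup>2 - 2 Re \<langle>S x, T x\<rangle>\<close>, so weak convergence to a unitary is already strong;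
  as unitaries are 1-Lipschitz, strong convergence is uniform on compact sets by a finite-net argument;
  and the adjoint is weakly continuous, so passing to the star topologies changes nothing. Complete
  metrizability comes from evaluating an operator and its adjoint on a dense sequence.\<close>

subsection \<open>Inner products and adjoints\<close>

text \<open>Restricting to unitaries matters beyond the comparison of topologies. In infinite
  dimension composition is not jointly strongly continuous on \<open>bounded_ops\<close>, and the
  adjoint is not strongly continuous there. The first is repaired by norm preservation, the second
  by proving weak continuity and transferring it along the equality of the topologies. Nets are
  replaced throughout by maps from an arbitrary space \<open>Z\<close> with the limit filters
  \<open>atin Z z\<close>: two topologies agree once \<open>id\<close> is continuous in both
  directions, and the same criterion serves the group operations. Since \<open>cadjoint\<close> is a
  definite description, its defining property is available only once an adjoint is shown to exist,
  which is what the Riesz representation is for.\<close>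

lemma cinner_add_right: "cinner x (y + z) = cinner x y + cinner x (z :: 'a::complex_hilbert_space)"
  by (metis cinner_add_left cinner_commute complex_cnj_add)

lemma cinner_scaleC_right: "cinner x (scaleC a y) = cnj a * cinner x (y :: 'a::complex_hilbert_space)"
  by (metis cinner_commute cinner_scaleC_left complex_cnj_mult)

lemma power2_norm_eq_cinner: "(norm x)\<^sup>2 = Re (cinner x (x :: 'a::complex_hilbert_space))"
  by (simp add: norm_eq_sqrt_cinner cinner_ge_zero)

text \<open>The normed-space structure provides homogeneity for real scalars; the complex case comes
  from the inner product.\<close>

lemma norm_scaleC: "norm (scaleC c x) = cmod c * norm (x :: 'a::complex_hilbert_space)"
proof (rule power2_eq_imp_eq)
  have "cinner (scaleC c x) (scaleC c x) = of_real ((cmod c)\<^sup>2) * cinner x x"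
    by (simp only: cinner_scaleC_left cinner_scaleC_right complex_norm_square mult_ac)
  then show "(norm (scaleC c x))\<^sup>2 = (cmod c * norm x)\<^sup>2"
    by (simp add: power2_norm_eq_cinner power_mult_distrib)
qed auto

text \<open>With \<open>- y\<close> in place of \<open>y\<close> this also yields the parallelogram
  law and the expansion of a squared distance.\<close>

lemma power2_norm_add:
  "(norm (x + y))\<^sup>2 = (norm x)\<^sup>2 + (norm y)\<^sup>2 + 2 * Re (cinner x (y :: 'a::complex_hilbert_space))"
proof -
  have "Re (cinner y x) = Re (cinner x y)"
    by (metis cinner_commute cnj.simps(1))
  then show ?thesis
    by (simp add: power2_norm_eq_cinner cinner_add_left cinner_add_right)
qed

text \<open>The usual order of deduction is reversed: the triangle inequality belongs to the class,
  and squaring it gives Cauchy-Schwarz for real parts.\<close>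

lemma Re_cinner_le: "Re (cinner x y) \<le> norm x * norm (y :: 'a::complex_hilbert_space)"
proof -
  have "(norm (x + y))\<^sup>2 \<le> (norm x + norm y)\<^sup>2"
    by (intro power_mono norm_triangle_ineq) auto
  then show ?thesis
    by (simp add: power2_norm_add power2_sum)
qed

lemma cmod_cinner_le: "cmod (cinner x y) \<le> norm x * norm (y :: 'a::complex_hilbert_space)"
proof (cases "cinner x y = 0")
  case False
  \<comment> \<open>The unimodular phase that rotates the inner product onto the nonnegative real
    axis, where the bound on real parts applies.\<close>
  define c where "c = cnj (cinner x y) / of_real (cmod (cinner x y))"
  have "c * cinner x y = of_real (cmod (cinner x y))"
    using False by (simp add: c_def divide_simps complex_norm_square [symmetric] power2_eq_square mult_ac)
  then have "cmod (cinner x y) = Re (cinner (scaleC c x) y)"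
    by (simp add: cinner_scaleC_left)
  also have "\<dots> \<le> norm (scaleC c x) * norm y"
    by (rule Re_cinner_le)
  also have "norm (scaleC c x) = norm x"
    using False by (simp add: norm_scaleC c_def norm_divide)
  finally show ?thesis .
qed auto

lemma bounded_bilinear_cinner:
  "bounded_bilinear (cinner :: 'a::complex_hilbert_space \<Rightarrow> 'a \<Rightarrow> complex)"
proof
  show "\<exists>K. \<forall>a b :: 'a. norm (cinner a b) \<le> norm a * norm b * K"
    by (rule exI[of _ 1]) (simp add: cmod_cinner_le)
qed (simp_all add: cinner_add_left cinner_add_right scaleR_scaleC cinner_scaleC_left
      cinner_scaleC_right scaleR_conv_of_real)

interpretation cinner: bounded_bilinear "cinner :: 'a::complex_hilbert_space \<Rightarrow> 'a \<Rightarrow> complex"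
  by (rule bounded_bilinear_cinner)

lemma bounded_linear_scaleC: "bounded_linear (scaleC c :: 'a::complex_hilbert_space \<Rightarrow> 'a)"
proof (rule bounded_linear_intro[of _ "cmod c"])
  show "scaleC c (r *\<^sub>R x) = r *\<^sub>R scaleC c x" for r and x :: 'a
    by (simp add: scaleR_scaleC scaleC_scaleC mult.commute)
qed (simp_all add: scaleC_add_right norm_scaleC mult.commute)

lemma cinner_ext_right:
  fixes y z :: "'a::complex_hilbert_space"
  assumes "\<And>x. cinner x y = cinner x z"
  shows "y = z"
proof -
  have "cinner (y - z) (y - z) = 0"
    using assms[of "y - z"] by (simp add: cinner.diff_right)
  then show ?thesis
    by (simp add: cinner_eq_zero_iff)
qed

text \<open>The representing vector is the minimiser of \<open>\<parallel>x\<parallel>\<^sup>2 - 2 f x\<close>; by the parallelogram law every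
  minimising sequence is Cauchy.\<close>

lemma real_riesz_representation:
  fixes f :: "'a::complex_hilbert_space \<Rightarrow> real"
  assumes "bounded_linear f"
  shows "\<exists>z. \<forall>x. f x = Re (cinner x z)"
proof -
  interpret f: bounded_linear f by fact
  define g where "g x = (norm x)\<^sup>2 - 2 * f x" for x
  obtain K where K: "\<And>x. norm (f x) \<le> norm x * K"
    using f.bounded by blast
  \<comment> \<open>Completing the square in \<open>norm x\<close>: the operator bound
    \<open>K\<close> of \<open>f\<close> keeps \<open>g\<close> above -K^2.\<close>
  have g_ge: "- K\<^sup>2 \<le> g x" for x
  proof -
    have "f x \<le> norm x * K"
      using K[of x] by simp
    moreover have "0 \<le> (norm x - K)\<^sup>2"
      by simp
    ultimately show ?thesis
      by (simp add: g_def power2_diff)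
  qed
  then have bdd: "bdd_below (range g)"
    by (intro bdd_belowI[of _ "- K\<^sup>2"]) auto
  define m where "m = Inf (range g)"
  have m_le: "m \<le> g x" for x
    unfolding m_def by (rule cInf_lower[OF _ bdd]) auto
  have "\<exists>x. g x < m + 1 / (real n + 1)" for n
  proof -
    have "Inf (range g) < m + 1 / (real n + 1)"
      unfolding m_def by simp
    then show ?thesis
      using cInf_lessD[of "range g"] by blast
  qed
  then obtain u where u: "\<And>n. g (u n) < m + 1 / (real n + 1)"
    by metis
  \<comment> \<open>Comparing \<open>m\<close> with \<open>g\<close> at the midpoint makes the
    linear terms cancel, so near-minimality of both points forces them together.\<close>
  have para: "(norm (x - y))\<^sup>2 \<le> 2 * (g x - m) + 2 * (g y - m)" for x y
  proof -
    have 1: "(norm (x - y))\<^sup>2 = 2 * (norm x)\<^sup>2 + 2 * (norm y)\<^sup>2 - (norm (x + y))\<^sup>2"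
      using power2_norm_add[of x y] power2_norm_add[of x "- y"] by (simp add: cinner.minus_right)
    have "m \<le> g ((1/2) *\<^sub>R (x + y))"
      by (rule m_le)
    also have "\<dots> = (norm (x + y))\<^sup>2 / 4 - f x - f y"
      by (simp add: g_def f.scaleR f.add power_divide add_divide_distrib)
    finally show ?thesis
      using 1 by (simp add: g_def)
  qed
  have "Cauchy u"
    unfolding Cauchy_altdef
  proof (intro allI impI)
    fix e :: real assume "e > 0"
    \<comment> \<open>Two minimality defects, each doubled by \<open>para\<close>, have to add up to
      less than e^2.\<close>
    then obtain N where N: "1 / (real N + 1) < e\<^sup>2 / 4"
      using nat_approx_posE[of "e\<^sup>2 / 4"] by (auto simp: add.commute)
    have close: "g (u k) - m < e\<^sup>2 / 4" if "k \<ge> N" for k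
    proof -
      have "g (u k) - m < 1 / (real k + 1)"
        using u[of k] by simp
      also have "\<dots> \<le> 1 / (real N + 1)"
        using that by (auto simp: frac_le)
      finally show ?thesis
        using N by simp
    qed
    have "dist (u k) (u n) < e" if "k \<ge> N" "n > k" for k n
    proof -
      have "(norm (u k - u n))\<^sup>2 < e\<^sup>2"
        using para[of "u k" "u n"] close[of k] close[of n] that by simp
      then show ?thesis
        using \<open>e > 0\<close> by (simp add: dist_norm power_less_imp_less_base)
    qed
    then show "\<exists>M. \<forall>m\<ge>M. \<forall>n>m. dist (u m) (u n) < e"
      by blast
  qed
  then obtain z where z: "u \<longlonglongrightarrow> z"
    using Cauchy_convergent convergent_def by blast
  have "(\<lambda>n. g (u n)) \<longlonglongrightarrow> g z"
    unfolding g_def by (intro tendsto_intros z f.tendsto)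
  moreover have "(\<lambda>n. m + 1 / (real n + 1)) \<longlonglongrightarrow> m + 0"
    using LIMSEQ_inverse_real_of_nat
    by (intro tendsto_intros) (simp add: inverse_eq_divide add.commute)
  ultimately have "g z \<le> m + 0"
    by (rule LIMSEQ_le) (use u in \<open>auto intro: less_imp_le\<close>)
  then have gz: "g z \<le> m"
    by simp
  have "f x = Re (cinner x z)" for x
  proof (rule ccontr)
    assume ne: "f x \<noteq> Re (cinner x z)"
    define b where "b = f x - Re (cinner z x)"
    have b: "b \<noteq> 0"
      using ne by (metis b_def cinner_commute cnj.simps(1) eq_iff_diff_eq_0)
    \<comment> \<open>First variation: minimality of \<open>z\<close> along the line through
      \<open>z\<close> in direction \<open>x\<close>, where \<open>b\<close> is the derivative that
      has to vanish.\<close>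
    have quad: "2 * t * b \<le> t\<^sup>2 * (norm x)\<^sup>2" for t
    proof -
      have "g z \<le> g (z + t *\<^sub>R x)"
        using gz m_le by (rule order_trans)
      then show ?thesis
        by (simp add: g_def b_def power2_norm_add cinner.scaleR_right f.add f.scaleR
            power_mult_distrib algebra_simps)
    qed
    show False
    proof (cases "norm x = 0")
      case True
      then show False
        using b by (simp add: b_def f.zero cinner.zero_right)
    next
      case False
      \<comment> \<open>This \<open>t\<close> minimises t^2 |x|^2 - 2 t b, the increment of
        \<open>g\<close> along the line, and so makes the inequality as strong as possible.\<close>
      then have "2 * (b / (norm x)\<^sup>2) * b \<le> b\<^sup>2 / (norm x)\<^sup>2"
        using quad[of "b / (norm x)\<^sup>2"] by (simp add: power2_eq_square divide_simps)
      then have "b\<^sup>2 \<le> 0"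
        using False by (simp add: divide_simps power2_eq_square split: if_splits)
      then show False
        using b by simp
    qed
  qed
  then show ?thesis
    by blast
qed

section \<open>Existence, uniqueness and boundedness of adjoints\<close>

lemma bounded_opsD:
  assumes "T \<in> bounded_ops"
  shows "bounded_linear T" "T (scaleC c x) = scaleC c (T x)"
    "T (x + y) = T x + T y" "T (x - y) = T x - T y"
  using assms by (auto simp: bounded_ops_def linear_add linear_diff bounded_linear.linear)

text \<open>A complex-linear functional is determined by its real part: real Riesz represents
  \<open>Re (cinner (T x) y)\<close>, and replacing \<open>x\<close> by \<open>scaleC \<i> x\<close>
  recovers the imaginary part.\<close>

lemma ex_cadjoint:
  fixes T :: "'a::complex_hilbert_space \<Rightarrow> 'a"
  assumes T: "T \<in> bounded_ops"
  shows "\<exists>S. \<forall>x y. cinner (T x) y = cinner x (S y)"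
proof -
  have "\<exists>z. \<forall>x. cinner (T x) y = cinner x z" for y
  proof -
    have bl: "bounded_linear (\<lambda>x. Re (cinner (T x) y))"
      using bounded_linear_compose[OF bounded_linear_Re
          bounded_linear_compose[OF cinner.bounded_linear_left bounded_opsD(1)[OF T]]] .
    obtain z where z: "\<And>x. Re (cinner (T x) y) = Re (cinner x z)"
      using real_riesz_representation[OF bl] by blast
    have "Im (cinner (T x) y) = Im (cinner x z)" for x
      using z[of "scaleC \<i> x"] by (simp add: bounded_opsD(2)[OF T] cinner_scaleC_left)
    then show ?thesis
      using z by (auto simp: complex_eq_iff)
  qed
  then show ?thesis
    by metis
qed

text \<open>The uniqueness half of the definite description; adjoints are identified below by
  exhibiting a candidate.\<close>

lemma cadjoint_eqI:
  assumes "\<And>x y. cinner (T x) y = cinner x (S y)"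
  shows "cadjoint T = S"
  unfolding cadjoint_def
proof (rule the_equality)
  fix R assume "\<forall>x y. cinner (T x) y = cinner x (R y)"
  then show "R = S"
    using assms by (metis cinner_ext_right ext)
qed (use assms in blast)

lemma cinner_cadjoint: "T \<in> bounded_ops \<Longrightarrow> cinner (T x) y = cinner x (cadjoint T y)"
  using ex_cadjoint cadjoint_eqI by metis

lemma cadjoint_bounded_ops:
  fixes T :: "'a::complex_hilbert_space \<Rightarrow> 'a"
  assumes T: "T \<in> bounded_ops"
  shows "cadjoint T \<in> bounded_ops"
proof -
  note adj = cinner_cadjoint[OF T, symmetric]
  obtain K where K: "\<And>x. norm (T x) \<le> norm x * K"
    using bounded_linear.bounded[OF bounded_opsD(1)[OF T]] by blast
  have scaleC: "cadjoint T (scaleC c x) = scaleC c (cadjoint T x)" for c x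
    by (rule cinner_ext_right) (simp add: adj cinner_scaleC_right)
  \<comment> \<open>Testing against \<open>cadjoint T y\<close> itself and cancelling one factor of
    its norm gives the bound \<open>K\<close> of \<open>T\<close>; the cancellation forces the case
    split.\<close>
  have "norm (cadjoint T y) \<le> norm y * K" for y
  proof (cases "norm (cadjoint T y) = 0")
    case True
    have "0 \<le> norm y * K"
      using K[of y] norm_ge_zero order_trans by blast
    with True show ?thesis
      by simp
  next
    case False
    have "(norm (cadjoint T y))\<^sup>2 = Re (cinner (T (cadjoint T y)) y)"
      by (simp add: power2_norm_eq_cinner adj)
    also have "\<dots> \<le> norm (T (cadjoint T y)) * norm y"
      by (rule Re_cinner_le)
    also have "\<dots> \<le> (norm (cadjoint T y) * K) * norm y"
      by (intro mult_right_mono K) auto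
    finally show ?thesis
      using False by (simp add: power2_eq_square mult_ac mult_le_cancel_left)
  qed
  moreover have "cadjoint T (x + y) = cadjoint T x + cadjoint T y" for x y
    by (rule cinner_ext_right) (simp add: adj cinner_add_right)
  ultimately have "bounded_linear (cadjoint T)"
    by (intro bounded_linear_intro[of _ K]) (simp_all add: scaleC scaleR_scaleC)
  with scaleC show ?thesis
    by (simp add: bounded_ops_def)
qed

subsection \<open>The unitary group\<close>

lemma unitaryI:
  assumes "T \<in> bounded_ops" "\<And>x y. cinner (T x) y = cinner x (S y)"
    and "\<And>x. T (S x) = x" "\<And>x. S (T x) = x"
  shows "T \<in> unitary_ops"
proof -
  have "cadjoint T = S"
    using assms(2) by (rule cadjoint_eqI)
  with assms show ?thesis
    by (auto simp: unitary_ops_def)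
qed

lemma unitary_bounded_ops: "T \<in> unitary_ops \<Longrightarrow> T \<in> bounded_ops"
  by (simp add: unitary_ops_def)

lemma unitary_cadjoint_cancel:
  assumes "T \<in> unitary_ops"
  shows "T (cadjoint T x) = x" "cadjoint T (T x) = x"
  using assms by (auto simp: unitary_ops_def fun_eq_iff)

lemma unitary_norm:
  assumes "T \<in> unitary_ops"
  shows "norm (T x) = norm x"
  by (simp add: norm_eq_sqrt_cinner cinner_cadjoint unitary_bounded_ops assms
      unitary_cadjoint_cancel)

text \<open>The Lipschitz constant does not depend on \<open>T\<close>. This uniformity drives the
  arguments on compact sets, joint continuity and dense sequences.\<close>

lemma unitary_norm_diff:
  assumes "T \<in> unitary_ops"
  shows "norm (T x - T y) = norm (x - y)"
  using unitary_norm[OF assms, of "x - y"]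
  by (simp add: bounded_opsD(4) unitary_bounded_ops assms)

lemma cadjoint_cadjoint:
  assumes "T \<in> bounded_ops"
  shows "cadjoint (cadjoint T) = T"
  by (rule cadjoint_eqI) (metis assms cinner_cadjoint cinner_commute)

lemma unitary_cadjoint: "T \<in> unitary_ops \<Longrightarrow> cadjoint T \<in> unitary_ops"
  by (simp add: unitary_ops_def cadjoint_bounded_ops cadjoint_cadjoint)

lemma unitary_id: "id \<in> unitary_ops"
  by (rule unitaryI[where S = id]) (auto simp: bounded_ops_def bounded_linear_ident id_def)

lemma bounded_ops_comp:
  assumes "S \<in> bounded_ops" "T \<in> bounded_ops"
  shows "S \<circ> T \<in> bounded_ops"
  using assms by (auto simp: bounded_ops_def o_def bounded_linear_compose)

lemma unitary_comp:
  assumes "S \<in> unitary_ops" "T \<in> unitary_ops"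
  shows "S \<circ> T \<in> unitary_ops"
  by (rule unitaryI[where S = "cadjoint T \<circ> cadjoint S"])
    (simp_all add: assms unitary_bounded_ops bounded_ops_comp cinner_cadjoint unitary_cadjoint_cancel)

lemma group_unitary_group: "group (unitary_group :: ('a::complex_hilbert_space \<Rightarrow> 'a) monoid)"
proof (rule groupI)
  fix T :: "'a \<Rightarrow> 'a" assume "T \<in> carrier unitary_group"
  then show "\<exists>S \<in> carrier unitary_group. S \<otimes>\<^bsub>unitary_group\<^esub> T = \<one>\<^bsub>unitary_group\<^esub>"
    by (intro bexI[of _ "cadjoint T"]) (auto simp: unitary_group_def unitary_cadjoint unitary_cadjoint_cancel fun_eq_iff)
qed (auto simp: unitary_group_def unitary_comp unitary_id comp_assoc)

text \<open>Reduces continuity of inversion to continuity of the adjoint.\<close>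

lemma inv_unitary_group:
  assumes "T \<in> unitary_ops"
  shows "inv\<^bsub>unitary_group\<^esub> T = cadjoint T"
proof (rule group.inv_equality[OF group_unitary_group])
  show "cadjoint T \<otimes>\<^bsub>unitary_group\<^esub> T = \<one>\<^bsub>unitary_group\<^esub>"
    using assms by (auto simp: unitary_group_def unitary_ops_def)
qed (use assms in \<open>auto simp: unitary_group_def unitary_cadjoint\<close>)

subsection \<open>Continuity into seminorm topologies\<close>

text \<open>The filter \<open>atin Z z\<close> sees punctured neighbourhoods; the point itself is
  covered because \<open>Q z\<close> is already known.\<close>

lemma openin_Collect_eventually:
  assumes "\<And>z. z \<in> topspace Z \<Longrightarrow> Q z \<Longrightarrow> eventually Q (atin Z z)"
  shows "openin Z {z \<in> topspace Z. Q z}"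
proof (subst openin_subopen, intro ballI)
  fix z assume z: "z \<in> {z \<in> topspace Z. Q z}"
  then obtain W where "openin Z W" "z \<in> W" "\<forall>w \<in> W - {z}. Q w"
    using assms[of z] by (auto simp: eventually_atin)
  with z show "\<exists>T. openin Z T \<and> z \<in> T \<and> T \<subseteq> {z \<in> topspace Z. Q z}"
    by (intro exI[of _ W]) (auto dest: openin_subset)
qed

lemma eventually_atin_topspace: "eventually (\<lambda>w. w \<in> topspace Z) (atin Z z)"
  by (auto simp: eventually_atin)

text \<open>Only differences of members of \<open>V\<close> occur, so the seminorm properties are required of these
  alone: a supremum over a compact set behaves only where it is bounded.\<close>

definition seminorm_on :: "('a \<Rightarrow> 'b::ab_group_add) set \<Rightarrow> (('a \<Rightarrow> 'b) \<Rightarrow> real) \<Rightarrow> bool" where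
  "seminorm_on V p \<longleftrightarrow> p (\<lambda>x. 0) = 0 \<and>
     (\<forall>S \<in> V. \<forall>T \<in> V. 0 \<le> p (\<lambda>x. S x - T x) \<and>
        (\<forall>R \<in> V. p (\<lambda>x. R x - T x) \<le> p (\<lambda>x. R x - S x) + p (\<lambda>x. S x - T x)))"

text \<open>Nonemptiness lets the balls cover \<open>V\<close>: the space of a generated topology is
  the union of its subbase.\<close>

definition seminorms_on :: "('a \<Rightarrow> 'b::ab_group_add) set \<Rightarrow> (('a \<Rightarrow> 'b) \<Rightarrow> real) set \<Rightarrow> bool" where
  "seminorms_on V P \<longleftrightarrow> P \<noteq> {} \<and> (\<forall>p \<in> P. seminorm_on V p)"

lemma seminorms_onD:
  assumes "seminorms_on V P" "p \<in> P"
  shows "p (\<lambda>x. 0) = 0"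
    and "S \<in> V \<Longrightarrow> T \<in> V \<Longrightarrow> 0 \<le> p (\<lambda>x. S x - T x)"
    and "R \<in> V \<Longrightarrow> S \<in> V \<Longrightarrow> T \<in> V \<Longrightarrow>
      p (\<lambda>x. R x - T x) \<le> p (\<lambda>x. R x - S x) + p (\<lambda>x. S x - T x)"
  using assms by (auto simp: seminorms_on_def seminorm_on_def)

lemma topspace_seminorm_topology:
  assumes "seminorms_on V P"
  shows "topspace (seminorm_topology V P) = V"
proof
  show "V \<subseteq> topspace (seminorm_topology V P)"
  proof
    fix T assume T: "T \<in> V"
    obtain p where p: "p \<in> P"
      using assms by (auto simp: seminorms_on_def)
    have "p (\<lambda>x. T x - T x) < 1"
      using seminorms_onD(1)[OF assms p] by simp
    with T p show "T \<in> topspace (seminorm_topology V P)"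
      unfolding seminorm_topology_def topology_generated_by_topspace
      by (intro UnionI[of "{S \<in> V. p (\<lambda>x. S x - T x) < 1}"]) (auto intro: zero_less_one)
  qed
qed (auto simp: seminorm_topology_def)

text \<open>Takes the place of the description by convergent nets. One direction uses balls centred
  at \<open>f z\<close>; in the other the subbasic balls have arbitrary centres, and the triangle
  inequality moves them.\<close>

lemma continuous_map_seminorm_topology:
  assumes P: "seminorms_on V P"
  shows "continuous_map Z (seminorm_topology V P) f \<longleftrightarrow> f \<in> topspace Z \<rightarrow> V \<and>
    (\<forall>z \<in> topspace Z. \<forall>p \<in> P. ((\<lambda>w. p (\<lambda>x. f w x - f z x)) \<longlongrightarrow> 0) (atin Z z))"
    (is "?lhs \<longleftrightarrow> ?rhs")
proof
  assume f: ?lhs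
  then have fV: "f \<in> topspace Z \<rightarrow> V"
    using continuous_map_funspace topspace_seminorm_topology[OF P] by metis
  moreover have "((\<lambda>w. p (\<lambda>x. f w x - f z x)) \<longlongrightarrow> 0) (atin Z z)"
    if z: "z \<in> topspace Z" and p: "p \<in> P" for z p
  proof (rule tendstoI)
    fix e :: real assume e: "e > 0"
    define B where "B = {S \<in> V. p (\<lambda>x. S x - f z x) < e}"
    have fz: "f z \<in> V"
      using fV z by auto
    then have "openin (seminorm_topology V P) B"
      unfolding seminorm_topology_def B_def using p e
      by (intro topology_generated_by_Basis) blast
    then have "openin Z {w \<in> topspace Z. f w \<in> B}"
      using f by (rule openin_continuous_map_preimage[rotated])
    moreover have "f z \<in> B"
      using fz e seminorms_onD(1)[OF P p] by (simp add: B_def)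
    moreover have "dist (p (\<lambda>x. f w x - f z x)) 0 < e" if "w \<in> topspace Z" "f w \<in> B" for w
      using that fz seminorms_onD(2)[OF P p] by (auto simp: B_def)
    ultimately show "\<forall>\<^sub>F w in atin Z z. dist (p (\<lambda>x. f w x - f z x)) 0 < e"
      unfolding eventually_atin using z
      by (intro disjI2 exI[of _ "{w \<in> topspace Z. f w \<in> B}"]) auto
  qed
  ultimately show ?rhs
    by blast
next
  assume R: ?rhs
  show ?lhs
    unfolding seminorm_topology_def
  proof (rule continuous_on_generated_topo)
    fix B assume "B \<in> {{S \<in> V. p (\<lambda>x. S x - T x) < e} | T p e. T \<in> V \<and> p \<in> P \<and> 0 < e}"
    then obtain T p e where B: "B = {S \<in> V. p (\<lambda>x. S x - T x) < e}" and T: "T \<in> V" "p \<in> P"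
      by auto
    have "openin Z {z \<in> topspace Z. f z \<in> B}"
    proof (rule openin_Collect_eventually)
      fix z assume z: "z \<in> topspace Z" "f z \<in> B"
      \<comment> \<open>The right-hand side is the room left between \<open>f z\<close> and the
        boundary of the ball around \<open>T\<close>.\<close>
      then have "\<forall>\<^sub>F w in atin Z z. p (\<lambda>x. f w x - f z x) < e - p (\<lambda>x. f z x - T x)"
        using R T by (intro order_tendstoD) (auto simp: B)
      then show "\<forall>\<^sub>F w in atin Z z. f w \<in> B"
        using eventually_atin_topspace
      proof eventually_elim
        case (elim w)
        then have "f w \<in> V" "f z \<in> V"
          using R z by auto
        then have "p (\<lambda>x. f w x - T x) \<le> p (\<lambda>x. f w x - f z x) + p (\<lambda>x. f z x - T x)"
          using T by (intro seminorms_onD(3)[OF P])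
        with elim \<open>f w \<in> V\<close> show ?case
          by (auto simp: B)
      qed
    qed
    moreover have "f -` B \<inter> topspace Z = {z \<in> topspace Z. f z \<in> B}"
      by auto
    ultimately show "openin Z (f -` B \<inter> topspace Z)"
      by simp
  next
    show "f ` topspace Z \<subseteq> \<Union>{{S \<in> V. p (\<lambda>x. S x - T x) < e} | T p e. T \<in> V \<and> p \<in> P \<and> 0 < e}"
      using R topspace_seminorm_topology[OF P]
      unfolding seminorm_topology_def topology_generated_by_topspace by auto
  qed
qed

lemma continuous_map_euclidean_iff_tendsto:
  fixes f :: "'b \<Rightarrow> 'c::real_normed_vector"
  shows "continuous_map Z euclidean f \<longleftrightarrow>
    (\<forall>z \<in> topspace Z. ((\<lambda>w. norm (f w - f z)) \<longlongrightarrow> 0) (atin Z z))"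
  by (simp add: continuous_map_atin tendsto_norm_zero_iff Lim_null[symmetric])

lemma norm_diff_triangle: "norm (a - c) \<le> norm (a - b) + norm (b - c :: 'a::real_normed_vector)"
  using dist_triangle[of a c b] by (simp add: dist_norm)

section \<open>The seminorm families of the three operator topologies\<close>

lemma seminorms_on_strong:
  "seminorms_on bounded_ops {\<lambda>T :: 'a::complex_hilbert_space \<Rightarrow> 'a. norm (T x) | x. True}"
  by (auto simp: seminorms_on_def seminorm_on_def norm_diff_triangle)

lemma seminorms_on_weak:
  "seminorms_on bounded_ops
     {\<lambda>T :: 'a::complex_hilbert_space \<Rightarrow> 'a. cmod (cinner (T x) y) | x y. True}"
  by (auto simp: seminorms_on_def seminorm_on_def cinner.diff_left cinner.zero_left norm_diff_triangle)

lemma bdd_above_norm_compact: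
  assumes "S \<in> bounded_ops" "T \<in> bounded_ops" "compact (C :: 'a::complex_hilbert_space set)"
  shows "bdd_above ((\<lambda>x. norm (S x - T x)) ` C)"
proof (intro compact_imp_bounded[THEN bounded_imp_bdd_above] compact_continuous_image assms(3))
  show "continuous_on C (\<lambda>x. norm (S x - T x))"
    using assms by (intro continuous_intros linear_continuous_on bounded_opsD)
qed

lemma SUP_norm_diff_nonneg:
  assumes "S \<in> bounded_ops" "T \<in> bounded_ops" "compact C" "C \<noteq> ({} :: 'a::complex_hilbert_space set)"
  shows "0 \<le> (SUP x\<in>C. norm (S x - T x))"
proof -
  obtain x where x: "x \<in> C"
    using assms(4) by blast
  have "0 \<le> norm (S x - T x)"
    by simp
  also have "\<dots> \<le> (SUP x\<in>C. norm (S x - T x))"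
    by (rule cSUP_upper[OF x bdd_above_norm_compact[OF assms(1-3)]])
  finally show ?thesis .
qed

lemma SUP_norm_diff_triangle:
  assumes V: "R \<in> bounded_ops" "S \<in> bounded_ops" "T \<in> bounded_ops"
    and C: "compact C" "C \<noteq> ({} :: 'a::complex_hilbert_space set)"
  shows "(SUP x\<in>C. norm (R x - T x)) \<le> (SUP x\<in>C. norm (R x - S x)) + (SUP x\<in>C. norm (S x - T x))"
proof (rule cSUP_least[OF C(2)])
  fix x assume x: "x \<in> C"
  have "norm (R x - T x) \<le> norm (R x - S x) + norm (S x - T x)"
    by (rule norm_diff_triangle)
  also have "\<dots> \<le> (SUP x\<in>C. norm (R x - S x)) + (SUP x\<in>C. norm (S x - T x))"
    by (rule add_mono[OF cSUP_upper[OF x bdd_above_norm_compact[OF V(1,2) C(1)]]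
          cSUP_upper[OF x bdd_above_norm_compact[OF V(2,3) C(1)]]])
  finally show "norm (R x - T x) \<le> (SUP x\<in>C. norm (R x - S x)) + (SUP x\<in>C. norm (S x - T x))" .
qed

lemma seminorms_on_compact_open:
  "seminorms_on bounded_ops
     {\<lambda>T :: 'a::complex_hilbert_space \<Rightarrow> 'a. SUP x\<in>C. norm (T x) | C. compact C \<and> C \<noteq> {}}"
proof -
  have "seminorm_on bounded_ops (\<lambda>T. SUP x\<in>C. norm (T x))"
    if "compact C" "C \<noteq> {}" for C :: "'a set"
    using that unfolding seminorm_on_def
    by (auto intro: SUP_norm_diff_nonneg SUP_norm_diff_triangle)
  moreover have "\<exists>C :: 'a set. compact C \<and> C \<noteq> {}"
    by (rule exI[of _ "{0}"]) simp
  ultimately show ?thesis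
    by (auto simp: seminorms_on_def)
qed

lemma topspace_operator_topologies:
  "topspace strong_topology = bounded_ops"
  "topspace weak_topology = bounded_ops"
  "topspace compact_open_topology = bounded_ops"
  unfolding strong_topology_def weak_topology_def compact_open_topology_def
    topspace_seminorm_topology[OF seminorms_on_strong] topspace_seminorm_topology[OF seminorms_on_weak]
    topspace_seminorm_topology[OF seminorms_on_compact_open]
  by (rule refl)+

text \<open>The strong topology is initial for the evaluations at vectors, as the weak one is for
  matrix coefficients.\<close>

lemma continuous_map_strong_topology:
  "continuous_map Z strong_topology f \<longleftrightarrow>
     f \<in> topspace Z \<rightarrow> bounded_ops \<and> (\<forall>x. continuous_map Z euclidean (\<lambda>z. f z x))"
  unfolding strong_topology_def continuous_map_seminorm_topology[OF seminorms_on_strong]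
    continuous_map_euclidean_iff_tendsto
  by auto

lemma continuous_map_weak_topology:
  "continuous_map Z weak_topology f \<longleftrightarrow>
     f \<in> topspace Z \<rightarrow> bounded_ops \<and> (\<forall>x y. continuous_map Z euclidean (\<lambda>z. cinner (f z x) y))"
proof -
  have ball: "(\<forall>p \<in> {h x y | x y. True}. Q p) \<longleftrightarrow> (\<forall>x y. Q (h x y))"
    for Q :: "(('b \<Rightarrow> 'b) \<Rightarrow> real) \<Rightarrow> bool" and h :: "'b \<Rightarrow> 'b \<Rightarrow> _"
    by blast
  show ?thesis
    unfolding weak_topology_def continuous_map_seminorm_topology[OF seminorms_on_weak]
      continuous_map_euclidean_iff_tendsto ball
    by (auto simp: cinner.diff_left)
qed

lemma continuous_map_compact_open_topology:
  "continuous_map Z compact_open_topology f \<longleftrightarrow>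
     f \<in> topspace Z \<rightarrow> bounded_ops \<and> (\<forall>z \<in> topspace Z. \<forall>C. compact C \<and> C \<noteq> {} \<longrightarrow>
        ((\<lambda>w. SUP x\<in>C. norm (f w x - f z x)) \<longlongrightarrow> 0) (atin Z z))"
  unfolding compact_open_topology_def continuous_map_seminorm_topology[OF seminorms_on_compact_open]
  by auto

subsection \<open>Comparison of the topologies\<close>

lemma topspace_star_topology: "topspace (star_topology X) = topspace X"
  unfolding star_topology_def topology_generated_by_topspace
  by (auto dest: openin_subset intro: exI[of _ "topspace X"])

lemma continuous_map_weak_imp_strong:
  fixes f :: "'b \<Rightarrow> 'a::complex_hilbert_space \<Rightarrow> 'a"
  assumes f: "continuous_map Z weak_topology f" and u: "f \<in> topspace Z \<rightarrow> unitary_ops"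
  shows "continuous_map Z strong_topology f"
  unfolding continuous_map_strong_topology continuous_map_euclidean_iff_tendsto
proof (intro conjI allI ballI)
  show "f \<in> topspace Z \<rightarrow> bounded_ops"
    using u unitary_bounded_ops by blast
  fix x z assume z: "z \<in> topspace Z"
  have eq: "(norm (f w x - f z x))\<^sup>2 = 2 * (norm x)\<^sup>2 - 2 * Re (cinner (f w x) (f z x))"
    if "w \<in> topspace Z" for w
    using power2_norm_add[of "f w x" "- f z x"] u z that
    by (simp add: cinner.minus_right unitary_norm Pi_iff)
  \<comment> \<open>Weak continuity is used with the test vector \<open>f z x\<close>, which stays
    fixed while \<open>w\<close> varies.\<close>
  have "continuous_map Z euclidean (\<lambda>w. cinner (f w x) (f z x))"
    using f unfolding continuous_map_weak_topology by blast
  then have "((\<lambda>w. cinner (f w x) (f z x)) \<longlongrightarrow> cinner (f z x) (f z x)) (atin Z z)"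
    using z by (simp add: continuous_map_atin)
  then have "((\<lambda>w. 2 * (norm x)\<^sup>2 - 2 * Re (cinner (f w x) (f z x)))
      \<longlongrightarrow> 2 * (norm x)\<^sup>2 - 2 * Re (cinner (f z x) (f z x))) (atin Z z)"
    by (intro tendsto_intros)
  \<comment> \<open>This is \<open>eq\<close> at \<open>w = z\<close>, where the distance is
    zero.\<close>
  also have "2 * (norm x)\<^sup>2 - 2 * Re (cinner (f z x) (f z x)) = 0"
    using eq[OF z] by simp
  finally have "((\<lambda>w. (norm (f w x - f z x))\<^sup>2) \<longlongrightarrow> 0) (atin Z z)"
    by (rule Lim_transform_eventually)
      (use eventually_atin_topspace in \<open>eventually_elim, simp add: eq\<close>)
  then show "((\<lambda>w. norm (f w x - f z x)) \<longlongrightarrow> 0) (atin Z z)"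
    using tendsto_real_sqrt by fastforce
qed

text \<open>Unitaries are equi-Lipschitz, so closeness on a finite \<open>e/4\<close>-net of \<open>C\<close> gives closeness on \<open>C\<close>.\<close>

lemma continuous_map_strong_imp_compact_open:
  fixes f :: "'b \<Rightarrow> 'a::complex_hilbert_space \<Rightarrow> 'a"
  assumes f: "continuous_map Z strong_topology f" and u: "f \<in> topspace Z \<rightarrow> unitary_ops"
  shows "continuous_map Z compact_open_topology f"
  unfolding continuous_map_compact_open_topology
proof (intro conjI allI ballI impI)
  show "f \<in> topspace Z \<rightarrow> bounded_ops"
    using u unitary_bounded_ops by blast
  fix z and C :: "'a set" assume z: "z \<in> topspace Z" and C: "compact C \<and> C \<noteq> {}"
  show "((\<lambda>w. SUP x\<in>C. norm (f w x - f z x)) \<longlongrightarrow> 0) (atin Z z)"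
  proof (rule tendstoI)
    fix e :: real assume e: "e > 0"
    \<comment> \<open>Radius \<open>e/4\<close> rather than \<open>e/3\<close>: passing to the
      supremum loses strictness, and \<open>3 * (e/4)\<close> is still below
      \<open>e\<close>.\<close>
    obtain F where F: "finite F" "C \<subseteq> (\<Union>y\<in>F. ball y (e/4))"
      using C e compact_eq_totally_bounded[of C] by (metis zero_less_divide_iff zero_less_numeral)
    have "\<forall>\<^sub>F w in atin Z z. norm (f w y - f z y) < e/4" for y
      using f z e unfolding continuous_map_strong_topology continuous_map_euclidean_iff_tendsto
      by (intro order_tendstoD) auto
    then have "\<forall>\<^sub>F w in atin Z z. \<forall>y\<in>F. norm (f w y - f z y) < e/4"
      by (simp add: eventually_ball_finite F(1))
    then show "\<forall>\<^sub>F w in atin Z z. dist (SUP x\<in>C. norm (f w x - f z x)) 0 < e"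
      using eventually_atin_topspace
    proof eventually_elim
      case (elim w)
      then have uwz: "f w \<in> unitary_ops" "f z \<in> unitary_ops"
        using u z by auto
      have "norm (f w x - f z x) \<le> 3 * (e/4)" if "x \<in> C" for x
      proof -
        obtain y where y: "y \<in> F" "norm (x - y) < e/4"
          using F(2) \<open>x \<in> C\<close> by (auto simp: dist_norm norm_minus_commute)
        have "f w x - f z x = (f w x - f w y) + (f w y - f z y) - (f z x - f z y)"
          by simp
        also have "norm \<dots> \<le> norm (f w x - f w y) + norm (f w y - f z y) + norm (f z x - f z y)"
          by (meson add_mono norm_triangle_ineq norm_triangle_ineq4 order_refl order_trans)
        finally show ?thesis
          using elim(1) y unitary_norm_diff[OF uwz(1), of x y] unitary_norm_diff[OF uwz(2), of x y]
          by fastforce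
      qed
      then have "(SUP x\<in>C. norm (f w x - f z x)) \<le> 3 * (e/4)"
        using C by (intro cSUP_least) auto
      moreover have "0 \<le> (SUP x\<in>C. norm (f w x - f z x))"
        using C uwz
        by (intro SUP_norm_diff_nonneg unitary_bounded_ops) auto
      ultimately show ?case
        using e by simp
    qed
  qed
qed

text \<open>Singletons are compact, so compact open convergence is pointwise, and Cauchy-Schwarz
  carries it to matrix coefficients.\<close>

lemma continuous_map_compact_open_imp_weak:
  fixes f :: "'b \<Rightarrow> 'a::complex_hilbert_space \<Rightarrow> 'a"
  assumes f: "continuous_map Z compact_open_topology f"
  shows "continuous_map Z weak_topology f"
  unfolding continuous_map_weak_topology continuous_map_euclidean_iff_tendsto
proof (intro conjI allI ballI)
  show "f \<in> topspace Z \<rightarrow> bounded_ops"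
    using f by (simp add: continuous_map_compact_open_topology)
  fix x y :: 'a and z assume z: "z \<in> topspace Z"
  have "((\<lambda>w. norm (f w x - f z x)) \<longlongrightarrow> 0) (atin Z z)"
    using conjunct2[OF f[unfolded continuous_map_compact_open_topology], rule_format, OF z, of "{x}"]
    by simp
  then have "((\<lambda>w. norm (f w x - f z x) * norm y) \<longlongrightarrow> 0) (atin Z z)"
    by (rule tendsto_mult_left_zero)
  then show "((\<lambda>w. cmod (cinner (f w x) y - cinner (f z x) y)) \<longlongrightarrow> 0) (atin Z z)"
    by (rule Lim_null_comparison[rotated]) (simp add: cmod_cinner_le flip: cinner.diff_left)
qed

lemma topology_eqI_continuous_id:
  assumes "topspace X = topspace Y" "continuous_map X Y id" "continuous_map Y X id"
  shows "X = Y"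
  using assms by (metis topology_eq topology_finer_continuous_id)

text \<open>The implications form a cycle weak, strong, compact open, weak. For each equality one
  direction is a single arrow applied to \<open>id\<close>, the other the composite of the remaining
  two.\<close>

lemma unitary_topologies_eq:
  "subtopology weak_topology unitary_ops = subtopology (strong_topology :: ('a::complex_hilbert_space \<Rightarrow> 'a) topology) unitary_ops"
  "subtopology compact_open_topology unitary_ops = subtopology (strong_topology :: ('a \<Rightarrow> 'a) topology) unitary_ops"
proof -
  note sub = continuous_map_from_subtopology[OF continuous_map_id]
  note [simp] = topspace_operator_topologies continuous_map_in_subtopology
  have ws: "continuous_map (subtopology weak_topology unitary_ops) (strong_topology :: ('a \<Rightarrow> 'a) topology) id"
    by (rule continuous_map_weak_imp_strong[OF sub]) auto
  have sc: "continuous_map (subtopology strong_topology unitary_ops) (compact_open_topology :: ('a \<Rightarrow> 'a) topology) id"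
    by (rule continuous_map_strong_imp_compact_open[OF sub]) auto
  have cw: "continuous_map (subtopology compact_open_topology unitary_ops) (weak_topology :: ('a \<Rightarrow> 'a) topology) id"
    by (rule continuous_map_compact_open_imp_weak[OF sub])
  have cs: "continuous_map (subtopology compact_open_topology unitary_ops) (strong_topology :: ('a \<Rightarrow> 'a) topology) id"
    by (rule continuous_map_weak_imp_strong[OF cw]) auto
  show "subtopology weak_topology unitary_ops = subtopology (strong_topology :: ('a \<Rightarrow> 'a) topology) unitary_ops"
    using ws continuous_map_compact_open_imp_weak[OF sc]
    by (intro topology_eqI_continuous_id) auto
  show "subtopology compact_open_topology unitary_ops = subtopology (strong_topology :: ('a \<Rightarrow> 'a) topology) unitary_ops"
    using cs sc by (intro topology_eqI_continuous_id) auto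
qed

text \<open>Matrix coefficients of the adjoint are conjugates of those of \<open>T\<close> with the
  vectors swapped, so weak continuity is immediate; on unitaries it is strong continuity as
  well.\<close>

lemma continuous_map_cadjoint:
  fixes X :: "('a::complex_hilbert_space \<Rightarrow> 'a) topology"
  defines "X \<equiv> subtopology strong_topology unitary_ops"
  shows "continuous_map X X cadjoint"
proof -
  have X: "X = subtopology weak_topology unitary_ops"
    by (simp add: X_def unitary_topologies_eq)
  have "continuous_map X weak_topology cadjoint"
    unfolding continuous_map_weak_topology
  proof (intro conjI allI)
    show "cadjoint \<in> topspace X \<rightarrow> bounded_ops"
      by (auto simp: X_def intro: cadjoint_bounded_ops unitary_bounded_ops)
    fix x y
    have "continuous_map X weak_topology id"
      by (simp add: X continuous_map_from_subtopology)
    then have "continuous_map X euclidean (\<lambda>T. cinner (T y) x)"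
      unfolding continuous_map_weak_topology by simp
    then have "continuous_map X euclidean (cnj \<circ> (\<lambda>T. cinner (T y) x))"
      by (rule continuous_map_compose) (simp add: continuous_on_cnj)
    then show "continuous_map X euclidean (\<lambda>T. cinner (cadjoint T x) y)"
      by (rule continuous_map_eq)
        (auto simp: X_def cinner_cadjoint unitary_bounded_ops simp flip: cinner_commute)
  qed
  then show ?thesis
    unfolding X continuous_map_in_subtopology
    by (auto simp: unitary_cadjoint)
qed

text \<open>The star topology refines \<open>X\<close> by construction. Conversely, its additional
  subbasic sets are preimages under \<open>cadjoint\<close>, hence open on the unitaries, where
  \<open>cadjoint\<close> is continuous.\<close>

lemma subtopology_star_topology:
  fixes X :: "('a::complex_hilbert_space \<Rightarrow> 'a) topology"
  assumes "subtopology X unitary_ops = subtopology strong_topology unitary_ops"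
    and "unitary_ops \<subseteq> topspace X"
  shows "subtopology (star_topology X) unitary_ops = subtopology strong_topology unitary_ops"
proof (rule topology_eqI_continuous_id)
  let ?Y = "subtopology X unitary_ops"
  have ts: "topspace ?Y = unitary_ops"
    using assms(2) by auto
  show "topspace (subtopology (star_topology X) unitary_ops) = topspace (subtopology strong_topology unitary_ops)"
    unfolding assms(1)[symmetric] by (simp add: topspace_star_topology)
  have "continuous_map (star_topology X) X id"
    unfolding continuous_map_def
  proof (intro conjI allI impI)
    show "id \<in> topspace (star_topology X) \<rightarrow> topspace X"
      by (simp add: topspace_star_topology)
    fix W assume W: "openin X W"
    then have "{T \<in> topspace (star_topology X). id T \<in> W} = W"
      using openin_subset by (auto simp: topspace_star_topology)
    moreover have "openin (star_topology X) W"
      unfolding star_topology_def using W by (intro topology_generated_by_Basis) simp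
    ultimately show "openin (star_topology X) {T \<in> topspace (star_topology X). id T \<in> W}"
      by simp
  qed
  then show "continuous_map (subtopology (star_topology X) unitary_ops) (subtopology strong_topology unitary_ops) id"
    unfolding assms(1)[symmetric] unfolding continuous_map_in_subtopology
    by (auto intro: continuous_map_from_subtopology)
  have adj: "continuous_map ?Y X cadjoint"
    using continuous_map_cadjoint[where 'a='a] unfolding assms(1)[symmetric] unfolding continuous_map_in_subtopology by blast
  have "continuous_map ?Y (star_topology X) id"
    unfolding star_topology_def
  proof (rule continuous_on_generated_topo)
    fix W assume "W \<in> {W. openin X W} \<union> {{T \<in> topspace X. cadjoint T \<in> W} | W. openin X W}"
    then consider "openin X W" | V where "openin X V" "W = {T \<in> topspace X. cadjoint T \<in> V}"
      by auto
    then show "openin ?Y (id -` W \<inter> topspace ?Y)"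
    proof cases
      case 1
      then show ?thesis
        by (simp add: ts openin_subtopology) blast
    next
      case 2
      have "id -` W \<inter> topspace ?Y = {T \<in> topspace ?Y. cadjoint T \<in> V}"
        by (auto simp: 2)
      with openin_continuous_map_preimage[OF adj 2(1)] show ?thesis
        by simp
    qed
  next
    show "id ` topspace ?Y \<subseteq> \<Union>({W. openin X W} \<union> {{T \<in> topspace X. cadjoint T \<in> W} | W. openin X W})"
      using openin_topspace[of X] by simp blast
  qed
  then show "continuous_map (subtopology strong_topology unitary_ops) (subtopology (star_topology X) unitary_ops) id"
    unfolding assms(1)[symmetric] unfolding continuous_map_in_subtopology by auto
qed

subsection \<open>The Polish group structure\<close>

text \<open>Near (S0, T0), write S T - S0 T0 = S (T - T0) + (S - S0) T0. As \<open>S\<close> is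
  isometric, the first term is as small as T - T0 at \<open>x\<close>, uniformly in
  \<open>S\<close>; the second is evaluated at the fixed vector T0 x.\<close>

lemma continuous_map_comp:
  fixes X :: "('a::complex_hilbert_space \<Rightarrow> 'a) topology"
  defines "X \<equiv> subtopology strong_topology unitary_ops"
  shows "continuous_map (prod_topology X X) X (\<lambda>(S, T). S \<circ> T)"
proof -
  let ?Z = "prod_topology X X"
  have ts: "topspace X = unitary_ops"
    by (auto simp: X_def topspace_operator_topologies unitary_bounded_ops)
  have "continuous_map X strong_topology id"
    by (simp add: X_def continuous_map_from_subtopology)
  then have eval: "continuous_map X euclidean (\<lambda>T. T x)" for x
    unfolding continuous_map_strong_topology by simp
  have fst: "continuous_map ?Z euclidean (\<lambda>w. fst w x)" for x
    using continuous_map_compose[OF continuous_map_fst eval] by (simp add: o_def)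
  have snd: "continuous_map ?Z euclidean (\<lambda>w. snd w x)" for x
    using continuous_map_compose[OF continuous_map_snd eval] by (simp add: o_def)
  have "continuous_map ?Z strong_topology (\<lambda>w. fst w \<circ> snd w)"
    unfolding continuous_map_strong_topology continuous_map_euclidean_iff_tendsto
  proof (intro conjI allI ballI)
    show "(\<lambda>w. fst w \<circ> snd w) \<in> topspace ?Z \<rightarrow> bounded_ops"
      by (auto simp: ts unitary_comp unitary_bounded_ops)
    fix x z assume z: "z \<in> topspace ?Z"
    have "((\<lambda>w. norm (snd w x - snd z x)) \<longlongrightarrow> 0) (atin ?Z z)"
      using snd z unfolding continuous_map_euclidean_iff_tendsto by blast
    moreover have "((\<lambda>w. norm (fst w (snd z x) - fst z (snd z x))) \<longlongrightarrow> 0) (atin ?Z z)"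
      using fst z unfolding continuous_map_euclidean_iff_tendsto by blast
    ultimately have "((\<lambda>w. norm (snd w x - snd z x) + norm (fst w (snd z x) - fst z (snd z x))) \<longlongrightarrow> 0)
        (atin ?Z z)"
      by (rule tendsto_add_zero)
    then show "((\<lambda>w. norm ((fst w \<circ> snd w) x - (fst z \<circ> snd z) x)) \<longlongrightarrow> 0) (atin ?Z z)"
    proof (rule Lim_null_comparison[rotated])
      show "\<forall>\<^sub>F w in atin ?Z z. norm (norm ((fst w \<circ> snd w) x - (fst z \<circ> snd z) x))
          \<le> norm (snd w x - snd z x) + norm (fst w (snd z x) - fst z (snd z x))"
        using eventually_atin_topspace
      proof eventually_elim
        case (elim w)
        then have "fst w \<in> unitary_ops"
          by (auto simp: ts)
        from unitary_norm_diff[OF this, of "snd w x" "snd z x"] show ?case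
          using norm_diff_triangle[of "fst w (snd w x)" "fst z (snd z x)" "fst w (snd z x)"] by simp
      qed
    qed
  qed
  then show ?thesis
    unfolding X_def continuous_map_in_subtopology
    using unitary_comp ts by (auto simp: case_prod_unfold X_def)
qed

lemma topological_group_unitary_group:
  "topological_group unitary_group
     (subtopology (strong_topology :: ('a::complex_hilbert_space \<Rightarrow> 'a) topology) unitary_ops)"
  (is "topological_group ?G ?X")
  unfolding topological_group_def
proof (intro conjI)
  show ts: "topspace ?X = carrier unitary_group"
    by (auto simp: unitary_group_def topspace_operator_topologies unitary_bounded_ops)
  show "group ?G"
    by (rule group_unitary_group)
  show "continuous_map (prod_topology ?X ?X) ?X (\<lambda>(S, T). S \<otimes>\<^bsub>?G\<^esub> T)"
    using continuous_map_comp by (simp add: unitary_group_def)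
  show "continuous_map ?X ?X (\<lambda>T. inv\<^bsub>?G\<^esub> T)"
    by (rule continuous_map_eq[OF continuous_map_cadjoint])
      (simp add: inv_unitary_group ts topspace_operator_topologies)
qed

text \<open>Sequences of unitaries are equi-Lipschitz, so convergence spreads from a dense set.\<close>

lemma unitary_tendsto_from_dense:
  fixes S :: "nat \<Rightarrow> 'a::complex_hilbert_space \<Rightarrow> 'a"
  assumes u: "\<And>k. S k \<in> unitary_ops" and D: "closure D = UNIV"
    and conv: "\<And>x. x \<in> D \<Longrightarrow> convergent (\<lambda>k. S k x)"
  shows "convergent (\<lambda>k. S k y)"
proof -
  have "Cauchy (\<lambda>k. S k y)"
  proof (rule metric_CauchyI)
    fix e :: real assume e: "e > 0"
    have "y \<in> closure D"
      using D by simp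
    then obtain x where x: "x \<in> D" "dist x y < e/3"
      using e closure_approachable[of y D] by (metis divide_pos_pos zero_less_numeral)
    obtain M where M: "\<And>m n. m \<ge> M \<Longrightarrow> n \<ge> M \<Longrightarrow> dist (S m x) (S n x) < e/3"
      using metric_CauchyD[OF convergent_Cauchy[OF conv[OF x(1)]], of "e/3"] e by auto
    have "dist (S m y) (S n y) < e" if "m \<ge> M" "n \<ge> M" for m n
    proof -
      have "dist (S m y) (S m x) < e/3" "dist (S n x) (S n y) < e/3"
        using x(2) by (simp_all add: dist_norm unitary_norm_diff u norm_minus_commute)
      then show ?thesis
        using M[OF that] dist_triangle[of "S m y" "S n y" "S m x"]
          dist_triangle[of "S m x" "S n y" "S n x"] by linarith
    qed
    then show "\<exists>M. \<forall>m\<ge>M. \<forall>n\<ge>M. dist (S m y) (S n y) < e"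
      by blast
  qed
  then show ?thesis
    by (rule Cauchy_convergent)
qed

text \<open>Gives closedness of the set of pairs of a unitary and its adjoint. Convergence of both
  is essential: the unilateral shift is a strong limit of unitaries.\<close>

lemma unitary_limit:
  fixes S :: "nat \<Rightarrow> 'a::complex_hilbert_space \<Rightarrow> 'a"
  assumes u: "\<And>k. S k \<in> unitary_ops"
    and L: "\<And>x. (\<lambda>k. S k x) \<longlonglongrightarrow> L x" and M: "\<And>x. (\<lambda>k. cadjoint (S k) x) \<longlonglongrightarrow> M x"
  shows "L \<in> unitary_ops" "cadjoint L = M"
proof -
  have b: "S k \<in> bounded_ops" for k
    using u by (rule unitary_bounded_ops)
  \<comment> \<open>Stated for a general sequence \<open>R\<close> so that it applies both to
    \<open>S\<close> and to the adjoints, giving the two inverse laws. Applying the isometry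
    \<open>R k\<close> turns the distance from \<open>cadjoint (R k) x\<close> to \<open>Q x\<close>
    into that from \<open>x\<close> to \<open>R k (Q x)\<close>.\<close>
  have comp: "P (Q x) = x"
    if "\<And>k. R k \<in> unitary_ops" "\<And>x. (\<lambda>k. R k x) \<longlonglongrightarrow> P x" "\<And>x. (\<lambda>k. cadjoint (R k) x) \<longlonglongrightarrow> Q x"
    for P Q x and R :: "nat \<Rightarrow> 'a \<Rightarrow> 'a"
  proof -
    have "(\<lambda>k. norm (cadjoint (R k) x - Q x)) \<longlonglongrightarrow> 0"
      using that(3)[of x] by (simp add: Lim_null[symmetric] tendsto_norm_zero_iff)
    moreover have "norm (cadjoint (R k) x - Q x) = norm (R k (Q x) - x)" for k
      using unitary_norm_diff[OF that(1), of k "cadjoint (R k) x" "Q x"]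
      by (simp add: unitary_cadjoint_cancel that(1) norm_minus_commute)
    ultimately have "(\<lambda>k. R k (Q x)) \<longlonglongrightarrow> x"
      by (simp add: Lim_null[symmetric] tendsto_norm_zero_iff)
    then show ?thesis
      using LIMSEQ_unique that(2) by blast
  qed
  have add: "L (x + y) = L x + L y" for x y
    using LIMSEQ_unique[OF L[of "x + y"]] tendsto_add[OF L[of x] L[of y]]
    by (simp add: bounded_opsD(3)[OF b])
  have scaleC: "L (scaleC c x) = scaleC c (L x)" for c x
    using LIMSEQ_unique[OF L[of "scaleC c x"]] bounded_linear.tendsto[OF bounded_linear_scaleC[of c] L[of x]]
    by (simp add: bounded_opsD(2)[OF b])
  have "norm (L x) = norm x" for x
    using LIMSEQ_unique[OF tendsto_norm[OF L[of x]], of "norm x"] by (simp add: unitary_norm u)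
  then have "bounded_linear L"
    by (intro bounded_linear_intro[of _ 1]) (simp_all add: add scaleC scaleR_scaleC)
  then have Lb: "L \<in> bounded_ops"
    by (simp add: bounded_ops_def scaleC)
  have adj: "cinner (L x) y = cinner x (M y)" for x y
    using LIMSEQ_unique[OF cinner.tendsto[OF L[of x] tendsto_const[of y]]]
      cinner.tendsto[OF tendsto_const[of x] M[of y]]
    by (simp add: cinner_cadjoint b)
  then show "cadjoint L = M"
    by (rule cadjoint_eqI)
  show "L \<in> unitary_ops"
  proof (rule unitaryI[OF Lb adj])
    show "L (M x) = x" for x
      by (rule comp[OF u L M])
    show "M (L x) = x" for x
      using comp[of "\<lambda>k. cadjoint (S k)" M L x] by (simp add: unitary_cadjoint u M L cadjoint_cadjoint b)
  qed
qed

text \<open>Evaluating \<open>S\<close> and its adjoint on a dense sequence embeds the unitaries homeomorphically into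
  a countable product of complete spaces. Recording the adjoint as well makes the image closed: a strong
  limit of unitaries alone is only an isometry.\<close>

lemma completely_metrizable_unitary_ops:
  assumes "\<exists>D :: 'a::complex_hilbert_space set. countable D \<and> closure D = UNIV"
  shows "completely_metrizable_space
    (subtopology (strong_topology :: ('a \<Rightarrow> 'a) topology) unitary_ops)" (is "completely_metrizable_space ?X")
proof -
  obtain D :: "'a set" where "countable D" and D: "closure D = UNIV"
    using assms by blast
  moreover have "D \<noteq> {}"
    using D by auto
  ultimately obtain d :: "nat \<Rightarrow> 'a" where d: "D = range d"
    using that[of "from_nat_into D"] by simp
  define F :: "('a \<Rightarrow> 'a) \<Rightarrow> nat \<Rightarrow> 'a \<times> 'a" where "F S = (\<lambda>n. (S (d n), cadjoint S (d n)))" for S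
  have ts: "topspace ?X = unitary_ops"
    by (auto simp: topspace_operator_topologies unitary_bounded_ops)
  have inj: "inj_on F unitary_ops"
  proof (rule inj_onI, rule ext)
    fix S T y assume S: "S \<in> unitary_ops" and T: "T \<in> unitary_ops" and "F S = F T"
    then have "S (d n) = T (d n)" for n
      by (auto simp: F_def fun_eq_iff)
    then have eq: "\<And>x. x \<in> D \<Longrightarrow> S x - T x = 0"
      by (auto simp: d)
    have "continuous_on (closure D) (\<lambda>x. S x - T x)"
      using S T by (intro continuous_intros linear_continuous_on bounded_opsD(1) unitary_bounded_ops)
    then have "S y - T y = 0"
      by (rule continuous_constant_on_closure) (use eq D in auto)
    then show "S y = T y"
      by simp
  qed
  \<comment> \<open>The product has countably many factors, so sequences detect closedness.\<close>
  have closed: "closed (F ` unitary_ops)"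
    unfolding closed_sequential_limits
  proof (intro allI impI, elim conjE)
    fix z l assume "\<forall>k. z k \<in> F ` unitary_ops" and zl: "z \<longlonglongrightarrow> l"
    then have "\<forall>k. \<exists>T. T \<in> unitary_ops \<and> z k = F T"
      by auto
    then obtain S where "\<forall>k. S k \<in> unitary_ops \<and> z k = F (S k)"
      by (rule choice[THEN exE])
    then have S: "\<And>k. S k \<in> unitary_ops" and z: "\<And>k. z k = F (S k)"
      by simp_all
    have "(\<lambda>k. z k n) \<longlonglongrightarrow> l n" for n
      by (rule continuous_on_tendsto_compose[OF continuous_on_product_coordinates zl]) auto
    then have "(\<lambda>k. S k (d n)) \<longlonglongrightarrow> fst (l n)" "(\<lambda>k. cadjoint (S k) (d n)) \<longlonglongrightarrow> snd (l n)" for n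
      using tendsto_fst[of "\<lambda>k. z k n" "l n"] tendsto_snd[of "\<lambda>k. z k n" "l n"] by (simp_all add: z F_def)
    note lim = this
    have "convergent (\<lambda>k. S k y)" "convergent (\<lambda>k. cadjoint (S k) y)" for y
      by (rule unitary_tendsto_from_dense[OF _ D]; use lim S in \<open>auto simp: d unitary_cadjoint convergent_def\<close>)+
    then have L: "\<And>y. (\<lambda>k. S k y) \<longlonglongrightarrow> lim (\<lambda>k. S k y)"
      and M: "\<And>y. (\<lambda>k. cadjoint (S k) y) \<longlonglongrightarrow> lim (\<lambda>k. cadjoint (S k) y)"
      by (simp_all add: convergent_LIMSEQ_iff)
    define L where "L = (\<lambda>y. lim (\<lambda>k. S k y))"
    have "l = F L"
      using LIMSEQ_unique[OF lim(1) L] LIMSEQ_unique[OF lim(2) M]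
      by (simp add: F_def fun_eq_iff prod_eq_iff L_def unitary_limit(2)[OF S L M])
    then show "l \<in> F ` unitary_ops"
      using unitary_limit(1)[OF S L M] by (simp add: L_def)
  qed
  let ?Y = "top_of_set (F ` unitary_ops)"
  define G where "G = inv_into unitary_ops F"
  have eval: "continuous_map ?X euclidean (\<lambda>S. S x)" for x
    using continuous_map_from_subtopology[OF continuous_map_id, of strong_topology unitary_ops]
    unfolding continuous_map_strong_topology by auto
  have eval': "continuous_map ?X euclidean (\<lambda>S. cadjoint S x)" for x
    using continuous_map_compose[OF continuous_map_cadjoint eval[of x]] by (simp add: o_def)
  have "continuous_map ?X euclidean (\<lambda>S. F S n)" for n
    unfolding F_def using continuous_map_pairedI[OF eval eval'] by simp
  then have "continuous_map ?X euclidean F"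
    using continuous_map_componentwise_UNIV[of ?X "\<lambda>_. euclidean" F]
    by (simp add: euclidean_product_topology)
  then have F: "continuous_map ?X ?Y F"
    by (auto simp: continuous_map_in_subtopology)
  have GF: "G (F S) = S" if "S \<in> unitary_ops" for S
    using that inj by (simp add: G_def inv_into_f_f)
  \<comment> \<open>The coordinates control an operator only at the vectors \<open>d n\<close>. A
    single \<open>d n\<close> within \<open>e/3\<close> of \<open>y\<close> suffices, since moving
    from \<open>y\<close> to \<open>d n\<close> costs the same under every unitary.\<close>
  have "continuous_map ?Y strong_topology G"
    unfolding continuous_map_strong_topology
  proof (intro conjI allI)
    show "G \<in> topspace ?Y \<rightarrow> bounded_ops"
      by (auto simp: GF unitary_bounded_ops)
    fix y
    show "continuous_map ?Y euclidean (\<lambda>z. G z y)"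
      unfolding continuous_map_euclidean_iff_tendsto
    proof (intro ballI tendstoI)
      fix z and e :: real assume z: "z \<in> topspace ?Y" and e: "e > 0"
      then obtain S where S: "S \<in> unitary_ops" "z = F S"
        by auto
      have "y \<in> closure D"
        using D by simp
      then obtain n where n: "dist (d n) y < e/3"
        using e closure_approachable[of y D] by (metis d divide_pos_pos rangeE zero_less_numeral)
      have "continuous_map ?Y euclidean (\<lambda>w. fst (w n))"
        by (auto intro!: continuous_on_fst intro: continuous_on_subset[OF continuous_on_product_coordinates])
      then have "((\<lambda>w. norm (fst (w n) - fst (z n))) \<longlongrightarrow> 0) (atin ?Y z)"
        using z unfolding continuous_map_euclidean_iff_tendsto by blast
      then have "\<forall>\<^sub>F w in atin ?Y z. norm (fst (w n) - fst (z n)) < e/3"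
        using e by (intro order_tendstoD) auto
      then show "\<forall>\<^sub>F w in atin ?Y z. dist (norm (G w y - G z y)) 0 < e"
        using eventually_atin_topspace
      proof eventually_elim
        case (elim w)
        then obtain T where T: "T \<in> unitary_ops" "w = F T"
          by auto
        have "norm (T y - T (d n)) < e/3" "norm (S (d n) - S y) < e/3"
          using n by (simp_all add: unitary_norm_diff S T dist_norm norm_minus_commute)
        moreover have "norm (T (d n) - S (d n)) < e/3"
          using elim(1) by (simp add: S T F_def)
        ultimately have "norm (T y - S y) < e"
          using norm_diff_triangle[of "T y" "S y" "T (d n)"]
            norm_diff_triangle[of "T (d n)" "S y" "S (d n)"] by linarith
        then show ?case
          by (simp add: S T GF)
      qed
    qed
  qed
  then have "continuous_map ?Y ?X G"
    by (auto simp: continuous_map_in_subtopology GF)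
  with F have "homeomorphic_maps ?X ?Y F G"
    by (auto simp: homeomorphic_maps_def GF)
  then have "?X homeomorphic_space ?Y"
    by (auto simp: homeomorphic_space_def)
  moreover have "completely_metrizable_space ?Y"
    by (rule completely_metrizable_space_closedin[OF completely_metrizable_space_euclidean])
      (simp add: closed)
  ultimately show ?thesis
    using homeomorphic_completely_metrizable_space by blast
qed

theorem theorem1p2:
  fixes U :: "('a::complex_hilbert_space \<Rightarrow> 'a) topology \<Rightarrow> ('a \<Rightarrow> 'a) topology"
  defines "U \<equiv> (\<lambda>X. subtopology X unitary_ops)"
  assumes separable: "\<exists>D :: 'a set. countable D \<and> closure D = UNIV"
    and infinite_dimensional: "\<not> (\<exists>B :: 'a set. finite B \<and> complex_vector.span B = UNIV)"
  shows "U (star_topology compact_open_topology) = U (star_topology strong_topology) \<and>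
         U (star_topology strong_topology) = U (star_topology weak_topology) \<and>
         U (star_topology weak_topology) = U compact_open_topology \<and>
         U compact_open_topology = U strong_topology \<and>
         U strong_topology = U weak_topology \<and>
         (\<forall>X \<in> {star_topology compact_open_topology, star_topology strong_topology,
                star_topology weak_topology, compact_open_topology, strong_topology,
                weak_topology}.
            polish_group unitary_group (U X))"
proof -
  have eq: "U weak_topology = U strong_topology" "U compact_open_topology = U strong_topology"
    unfolding U_def by (rule unitary_topologies_eq)+
  \<comment> \<open>Agreement of \<open>X\<close> with the strong topology on the unitaries is all
    that distinguishes the three cases, so one argument treats them together.\<close>
  have star: "U (star_topology X) = U strong_topology"
    if "U X = U strong_topology" "topspace X = bounded_ops" for X
    using that(1) unfolding U_def
    by (rule subtopology_star_topology) (use that(2) unitary_bounded_ops in blast)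
  note star_eq = star[OF eq(2) topspace_operator_topologies(3)]
    star[OF refl topspace_operator_topologies(1)] star[OF eq(1) topspace_operator_topologies(2)]
  \<comment> \<open>All six subspace topologies are now equal, so the group and metrizability claims
    are checked for one of them; separability provides the dense sequence.\<close>
  have "polish_group unitary_group (U strong_topology)"
    unfolding U_def polish_group_def
    by (rule conjI[OF topological_group_unitary_group completely_metrizable_unitary_ops[OF separable]])
  then show ?thesis
    by (simp add: eq star_eq)
qed

end
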